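(* Let $D$ be a defeasible theory, let $S_D$ and $S^*_D$ be its compiled programs, and let $q(\vec a)$ be a ground literal ($q$ is $p$ or $\neg p$ in $D$, written $\mathtt{p}$ or $\mathtt{not\_p}$ in the programs). Then $q(\vec a)\in P_\Delta$ iff $S_D\models_{WF}\mathtt{definitely\_q}(\vec a)$ iff $S^*_D\models_{WF}\mathtt{definitely\_q}(\vec a)$; and $q(\vec a)\in P_\lambda$ iff $S_D\models_{WF}\mathtt{lambda\_q}(\vec a)$ iff $S^*_D\models_{WF}\mathtt{lambda\_q}(\vec a)$.
   Context: Defeasible theories. A literal is an atom $p(t_1,\dots,t_n)$ or its classical negation; ${\sim}q$ is the complementary literal. A defeasible theory $D=(F,R,>)$ consists of a finite set $F$ of variable-free literals (facts), a finite set $R$ of labelled rules $r$ with antecedent set $A(r)$, consequent $C(r)$ and kind strict ($\to$), defeasible ($\Rightarrow$) or defeater ($\leadsto$), and an acyclic superiority relation $>$ on labels. $R_s$: strict rules; $R_{sd}$: strict or defeasible rules; $R[q]$: rules with consequent $q$. A non-ground theory is identified with the set of ground instances of its rules. $P_\Delta$ is the least set of ground literals with $q\in P_\Delta$ whenever $q\in F$ or some $r\in R_s[q]$ has $A(r)\subseteq P_\Delta$. $P_\lambda$ is the least set with $q\in P_\lambda$ whenever $q\in P_\Delta$, or some $r\in R_{sd}[q]$ has $A(r)\subseteq P_\lambda$ and ${\sim}q\notin P_\Delta$. Compiled programs. For a literal $q$ with predicate $p$, $\mathtt{q}$ denotes $\mathtt{p}$ if $q$ is positive and $\mathtt{not\_p}$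 if negative; $\mathtt{{\sim}q}$ is the name of the complement; predicate names are formed by concatenation; rule labels are constants. $S_D$ consists exactly of: (i) for each fact $q(\vec a)$: unit clauses $\mathtt{definitely\_q}(\vec a)$, $\mathtt{lambda\_q}(\vec a)$, $\mathtt{defeasibly\_q}(\vec a)$; (ii) for each strict rule $r:q_1(\vec a_1),\dots,q_n(\vec a_n)\to q(\vec a)$: $\mathtt{definitely\_q}(\vec a)\,\text{:-}\,\mathtt{body}^\Delta_r(\vec a)$, $\mathtt{lambda\_q}(\vec a)\,\text{:-}\,\mathtt{body}^\Delta_r(\vec a)$, $\mathtt{defeasibly\_q}(\vec a)\,\text{:-}\,\mathtt{body}^\Delta_r(\vec a)$, $\mathtt{body}^\Delta_r(\vec a)\,\text{:-}\,\mathtt{definitely\_q_1}(\vec a_1),\dots,\mathtt{definitely\_q_n}(\vec a_n)$; (iii) for each strict or defeasible rule $r:q_1(\vec a_1),\dots,q_n(\vec a_n)\hookrightarrow q(\vec a)$: $\mathtt{lambda\_q}(\vec a)\,\text{:-}\,not\ \mathtt{definitely\_{\sim}q}(\vec a),\mathtt{body}^\lambda_r(\vec a)$ and $\mathtt{defeasibly\_q}(\vec a)\,\text{:-}\,not\ \mathtt{definitely\_{\sim}q}(\vec a),\mathtt{body}^d_r(\vec a),not\ \mathtt{overruled\_q}(\vec a)$; (iv) for each rule $s$ of any kind, $s:q_1(\vec a_1),\dots,q_n(\vec a_n)\hookrightarrow q(\vec a)$: $\mathtt{body}^\lambda_s(\vec a)\,\text{:-}\,\mathtt{lambda\_q_1}(\vec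 a_1),\dots,\mathtt{lambda\_q_n}(\vec a_n)$, $\mathtt{body}^d_s(\vec a)\,\text{:-}\,\mathtt{defeasibly\_q_1}(\vec a_1),\dots,\mathtt{defeasibly\_q_n}(\vec a_n)$, $\mathtt{overruled\_{\sim}q}(\vec a)\,\text{:-}\,\mathtt{body}^\lambda_s(\vec a),not\ \mathtt{defeated\_q}(s,\vec a)$; (v) for each strict or defeasible rule $t$ with consequent $q(\vec a)$ and each rule $s$ with consequent of the form ${\sim}q(\dots)$ with $t>s$: $\mathtt{defeated\_{\sim}q}(s,\vec a)\,\text{:-}\,\mathtt{body}^d_t(\vec a)$. $S^*_D$ is the same as $S_D$ except that the $\mathtt{defeasibly\_q}$ clauses of (iii), the $\mathtt{overruled}$ clauses of (iv) and the clauses of (v) are replaced by: for each strict or defeasible rule $r$ with consequent $q(\vec a)$, $\mathtt{defeasibly\_q}(\vec a)\,\text{:-}\,not\ \mathtt{definitely\_{\sim}q}(\vec a),\mathtt{body}^d_r(\vec a),not\ \mathtt{overruled\_q}(r,\vec a)$; for each such $r$ and each rule $s$ with consequent ${\sim}q(\vec b)$, $\mathtt{overruled\_q}(r,\vec b)\,\text{:-}\,\mathtt{body}^\lambda_s(\vec b),not\ \mathtt{defeats\_q}(r,s)$; for each $r>s$ with $r$ having consequent literal $q$, the unit clause $\mathtt{defeats\_q}(r,s)$. $P\models_{WF}\ell$ means the ground literal $\ell$ holds in the well-founded model of the logic program $P$. *)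

theory Defs
  imports Main
begin

text \<open>\<open>Holds a\<close> is the literal \<open>a\<close>, \<open>Naf a\<close> is the literal \<open>not a\<close>.\<close>

datatype 'a plit = Holds (plit_atom: 'a) | Naf (plit_atom: 'a)

fun naf_compl :: "'a plit \<Rightarrow> 'a plit" where
  "naf_compl (Holds a) = Naf a"
| "naf_compl (Naf a) = Holds a"

datatype 'a clause = Clause (clause_head: 'a) (clause_body: "'a plit set")

text \<open>
  Van Gelder, Ross and Schlipf's definition for a ground program \<open>P\<close>; a partial interpretation
  is the set of literals it makes true. The type \<open>'a\<close> serves as the Herbrand base: atoms that
  head no clause belong to every greatest unfounded set, so they are false.
\<close>

definition immediate_consequences :: "'a clause set \<Rightarrow> 'a plit set \<Rightarrow> 'a set" where
  "immediate_consequences P I = {clause_head c | c. c \<in> P \<and> clause_body c \<subseteq> I}"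

definition unfounded :: "'a clause set \<Rightarrow> 'a plit set \<Rightarrow> 'a set \<Rightarrow> bool" where
  "unfounded P I U \<longleftrightarrow>
     (\<forall>c\<in>P. clause_head c \<in> U \<longrightarrow>
        (\<exists>l\<in>clause_body c. naf_compl l \<in> I) \<or> (\<exists>a\<in>U. Holds a \<in> clause_body c))"

definition greatest_unfounded :: "'a clause set \<Rightarrow> 'a plit set \<Rightarrow> 'a set" where
  "greatest_unfounded P I = \<Union>{U. unfounded P I U}"

definition wf_operator :: "'a clause set \<Rightarrow> 'a plit set \<Rightarrow> 'a plit set" where
  "wf_operator P I = Holds ` immediate_consequences P I \<union> Naf ` greatest_unfounded P I"

lemma mono_wf_operator: "mono (wf_operator P)"
proof (rule monoI)
  fix I J :: "'a plit set"
  assume IJ: "I \<subseteq> J"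
  have "immediate_consequences P I \<subseteq> immediate_consequences P J"
    using IJ unfolding immediate_consequences_def by blast
  moreover have "unfounded P J U" if "unfounded P I U" for U
    using that IJ unfolding unfounded_def by blast
  then have "greatest_unfounded P I \<subseteq> greatest_unfounded P J"
    unfolding greatest_unfounded_def by blast
  ultimately show "wf_operator P I \<subseteq> wf_operator P J"
    unfolding wf_operator_def by blast
qed

definition well_founded_model :: "'a clause set \<Rightarrow> 'a plit set" where
  "well_founded_model P = lfp (wf_operator P)"

datatype ('f, vars: 'v) tm = Var 'v | Fun 'f "('f, 'v) tm list"

primrec subst :: "('v \<Rightarrow> ('f, 'v) tm) \<Rightarrow> ('f, 'v) tm \<Rightarrow> ('f, 'v) tm" where
  "subst \<sigma> (Var x) = \<sigma> x"
| "subst \<sigma> (Fun f ts) = Fun f (map (subst \<sigma>) ts)"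

text \<open>\<open>(f, n) \<in> \<Sigma>\<close> means that \<open>f\<close> is an \<open>n\<close>-ary function symbol of the language.\<close>

inductive_set terms :: "('f \<times> nat) set \<Rightarrow> ('f, 'v) tm set" for \<Sigma> where
  "Var x \<in> terms \<Sigma>"
| "(f, length ts) \<in> \<Sigma> \<Longrightarrow> \<forall>t\<in>set ts. t \<in> terms \<Sigma> \<Longrightarrow> Fun f ts \<in> terms \<Sigma>"

definition herbrand_universe :: "('f \<times> nat) set \<Rightarrow> ('f, 'v) tm set" where
  "herbrand_universe \<Sigma> = {t \<in> terms \<Sigma>. vars t = {}}"

text \<open>
  Only the variables in \<open>X\<close> are required to become ground, so that a variable-free rule or clause
  is an instance of itself even if \<open>\<Sigma>\<close> contains no constant.
\<close>

definition grounding_substs :: "('f \<times> nat) set \<Rightarrow> 'v set \<Rightarrow> ('v \<Rightarrow> ('f, 'v) tm) set" where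
  "grounding_substs \<Sigma> X = {\<sigma>. \<forall>x\<in>X. \<sigma> x \<in> herbrand_universe \<Sigma>}"

text \<open>
  \<open>Pos p\<close> and \<open>Neg p\<close> are the signed predicates \<open>p\<close> and \<open>\<not> p\<close>; \<open>Lit q ts\<close> is the literal
  \<open>q(ts)\<close>, where \<open>q\<close> is a signed predicate.
\<close>

datatype 'p signed = Pos 'p | Neg 'p

fun negate :: "'p signed \<Rightarrow> 'p signed" where
  "negate (Pos p) = Neg p"
| "negate (Neg p) = Pos p"

datatype ('p, 'f, 'v) lit = Lit (lit_pred: "'p signed") (lit_args: "('f, 'v) tm list")

definition complement :: "('p, 'f, 'v) lit \<Rightarrow> ('p, 'f, 'v) lit" where
  "complement q = Lit (negate (lit_pred q)) (lit_args q)"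

definition subst_lit :: "('v \<Rightarrow> ('f, 'v) tm) \<Rightarrow> ('p, 'f, 'v) lit \<Rightarrow> ('p, 'f, 'v) lit" where
  "subst_lit \<sigma> q = Lit (lit_pred q) (map (subst \<sigma>) (lit_args q))"

definition lit_vars :: "('p, 'f, 'v) lit \<Rightarrow> 'v set" where
  "lit_vars q = (\<Union>t\<in>set (lit_args q). vars t)"

definition lits_over :: "('f \<times> nat) set \<Rightarrow> ('p, 'f, 'v) lit set" where
  "lits_over \<Sigma> = {q. set (lit_args q) \<subseteq> terms \<Sigma>}"

definition ground_lits :: "('f \<times> nat) set \<Rightarrow> ('p, 'f, 'v) lit set" where
  "ground_lits \<Sigma> = {q. set (lit_args q) \<subseteq> herbrand_universe \<Sigma>}"

datatype kind = Strict | Defeasible | Defeater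

record ('p, 'f, 'v, 'l) rule =
  label :: 'l
  kind :: kind
  antecedent :: "('p, 'f, 'v) lit set"
  consequent :: "('p, 'f, 'v) lit"

text \<open>\<open>(r, s) \<in> superiority D\<close> means \<open>r > s\<close>.\<close>

record ('p, 'f, 'v, 'l) defeasible_theory =
  facts :: "('p, 'f, 'v) lit set"
  rules :: "('p, 'f, 'v, 'l) rule set"
  superiority :: "('l \<times> 'l) set"

definition strict_rules :: "('p, 'f, 'v, 'l) defeasible_theory \<Rightarrow> ('p, 'f, 'v, 'l) rule set" where
  "strict_rules D = {r \<in> rules D. kind r = Strict}"

definition sd_rules :: "('p, 'f, 'v, 'l) defeasible_theory \<Rightarrow> ('p, 'f, 'v, 'l) rule set" where
  "sd_rules D = {r \<in> rules D. kind r = Strict \<or> kind r = Defeasible}"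

text \<open>
  Distinct rules carry distinct labels, so that a label identifies a rule (its ground instances
  share the label).
\<close>

definition is_defeasible_theory ::
  "('f \<times> nat) set \<Rightarrow> ('p, 'f, 'v, 'l) defeasible_theory \<Rightarrow> bool" where
  "is_defeasible_theory \<Sigma> D \<longleftrightarrow>
     finite (facts D) \<and> facts D \<subseteq> ground_lits \<Sigma> \<and>
     finite (rules D) \<and> inj_on label (rules D) \<and>
     (\<forall>r\<in>rules D. finite (antecedent r) \<and> antecedent r \<subseteq> lits_over \<Sigma> \<and>
        consequent r \<in> lits_over \<Sigma>) \<and>
     acyclic (superiority D)"

definition rule_vars :: "('p, 'f, 'v, 'l) rule \<Rightarrow> 'v set" where
  "rule_vars r = lit_vars (consequent r) \<union> (\<Union>q\<in>antecedent r. lit_vars q)"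

definition subst_rule ::
  "('v \<Rightarrow> ('f, 'v) tm) \<Rightarrow> ('p, 'f, 'v, 'l) rule \<Rightarrow> ('p, 'f, 'v, 'l) rule" where
  "subst_rule \<sigma> r =
     r\<lparr>antecedent := subst_lit \<sigma> ` antecedent r, consequent := subst_lit \<sigma> (consequent r)\<rparr>"

definition ground_theory ::
  "('f \<times> nat) set \<Rightarrow> ('p, 'f, 'v, 'l) defeasible_theory \<Rightarrow> ('p, 'f, 'v, 'l) defeasible_theory" where
  "ground_theory \<Sigma> D =
     D\<lparr>rules := {subst_rule \<sigma> r | \<sigma> r. r \<in> rules D \<and> \<sigma> \<in> grounding_substs \<Sigma> (rule_vars r)}\<rparr>"

text \<open>These sets are meant for ground theories, that is, for \<open>ground_theory \<Sigma> D\<close>.\<close>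

inductive_set P_Delta :: "('p, 'f, 'v, 'l) defeasible_theory \<Rightarrow> ('p, 'f, 'v) lit set" for D where
  fact: "q \<in> facts D \<Longrightarrow> q \<in> P_Delta D"
| strict: "r \<in> strict_rules D \<Longrightarrow> consequent r = q \<Longrightarrow> \<forall>a\<in>antecedent r. a \<in> P_Delta D
    \<Longrightarrow> q \<in> P_Delta D"

inductive_set P_lambda :: "('p, 'f, 'v, 'l) defeasible_theory \<Rightarrow> ('p, 'f, 'v) lit set" for D where
  Delta: "q \<in> P_Delta D \<Longrightarrow> q \<in> P_lambda D"
| sd: "r \<in> sd_rules D \<Longrightarrow> consequent r = q \<Longrightarrow> \<forall>a\<in>antecedent r. a \<in> P_lambda D
    \<Longrightarrow> complement q \<notin> P_Delta D \<Longrightarrow> q \<in> P_lambda D"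

text \<open>
  Structured predicate names stand for the concatenated ones, so that different names cannot
  clash: \<open>Definitely (Neg p)\<close> is \<open>definitely_not_p\<close>, \<open>Body_Delta r\<close> is the predicate
  \<open>body\<^sup>\<Delta>\<^sub>r\<close> of the rule labelled \<open>r\<close>, and so on.
\<close>

datatype ('p, 'l) pred =
    Definitely "'p signed"
  | Lambda "'p signed"
  | Defeasibly "'p signed"
  | Overruled "'p signed"
  | Defeated "'p signed"
  | Defeats "'p signed"
  | Body_Delta 'l
  | Body_lambda 'l
  | Body_d 'l

text \<open>
  An argument is a term of the theory or a rule label. Labels are constants of their own, not
  members of \<open>\<Sigma>\<close>: the variables of a compiled program range over the same Herbrand universe as
  those of the theory. With labels in their range, a rule whose antecedent contains variables that
  are absent from its consequent could have additional instances in the program only.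
\<close>

datatype ('f, 'v, 'l) arg = Tm "('f, 'v) tm" | Label 'l

datatype ('p, 'f, 'v, 'l) atom = Atom (atom_pred: "('p, 'l) pred") (atom_args: "('f, 'v, 'l) arg list")

type_synonym ('p, 'f, 'v, 'l) program = "('p, 'f, 'v, 'l) atom clause set"

text \<open>\<open>at P ts\<close> is \<open>P(ts)\<close>; \<open>at_label P l ts\<close> is \<open>P(l, ts)\<close>.\<close>

definition at :: "('p, 'l) pred \<Rightarrow> ('f, 'v) tm list \<Rightarrow> ('p, 'f, 'v, 'l) atom" where
  "at P ts = Atom P (map Tm ts)"

definition at_label :: "('p, 'l) pred \<Rightarrow> 'l \<Rightarrow> ('f, 'v) tm list \<Rightarrow> ('p, 'f, 'v, 'l) atom" where
  "at_label P l ts = Atom P (Label l # map Tm ts)"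

definition fact_clauses :: "('p, 'f, 'v) lit \<Rightarrow> ('p, 'f, 'v, 'l) program" where
  "fact_clauses f = (let q = lit_pred f; a = lit_args f in
     {Clause (at (Definitely q) a) {},
      Clause (at (Lambda q) a) {},
      Clause (at (Defeasibly q) a) {}})"

definition strict_clauses :: "('p, 'f, 'v, 'l) rule \<Rightarrow> ('p, 'f, 'v, 'l) program" where
  "strict_clauses r = (let q = lit_pred (consequent r); a = lit_args (consequent r) in
     {Clause (at (Definitely q) a) {Holds (at (Body_Delta (label r)) a)},
      Clause (at (Lambda q) a) {Holds (at (Body_Delta (label r)) a)},
      Clause (at (Defeasibly q) a) {Holds (at (Body_Delta (label r)) a)},
      Clause (at (Body_Delta (label r)) a)
        ((\<lambda>b. Holds (at (Definitely (lit_pred b)) (lit_args b))) ` antecedent r)})"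

definition lambda_clause :: "('p, 'f, 'v, 'l) rule \<Rightarrow> ('p, 'f, 'v, 'l) atom clause" where
  "lambda_clause r = (let q = lit_pred (consequent r); a = lit_args (consequent r) in
     Clause (at (Lambda q) a)
       {Naf (at (Definitely (negate q)) a), Holds (at (Body_lambda (label r)) a)})"

definition defeasibly_clause :: "('p, 'f, 'v, 'l) rule \<Rightarrow> ('p, 'f, 'v, 'l) atom clause" where
  "defeasibly_clause r = (let q = lit_pred (consequent r); a = lit_args (consequent r) in
     Clause (at (Defeasibly q) a)
       {Naf (at (Definitely (negate q)) a), Holds (at (Body_d (label r)) a),
        Naf (at (Overruled q) a)})"

definition body_clauses :: "('p, 'f, 'v, 'l) rule \<Rightarrow> ('p, 'f, 'v, 'l) program" where
  "body_clauses s = (let a = lit_args (consequent s) in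
     {Clause (at (Body_lambda (label s)) a)
        ((\<lambda>b. Holds (at (Lambda (lit_pred b)) (lit_args b))) ` antecedent s),
      Clause (at (Body_d (label s)) a)
        ((\<lambda>b. Holds (at (Defeasibly (lit_pred b)) (lit_args b))) ` antecedent s)})"

definition overruled_clause :: "('p, 'f, 'v, 'l) rule \<Rightarrow> ('p, 'f, 'v, 'l) atom clause" where
  "overruled_clause s = (let q = lit_pred (consequent s); a = lit_args (consequent s) in
     Clause (at (Overruled (negate q)) a)
       {Holds (at (Body_lambda (label s)) a), Naf (at_label (Defeated q) (label s) a)})"

definition defeated_clause ::
  "('p, 'f, 'v, 'l) rule \<Rightarrow> ('p, 'f, 'v, 'l) rule \<Rightarrow> ('p, 'f, 'v, 'l) atom clause" where
  "defeated_clause t s = (let q = lit_pred (consequent t); a = lit_args (consequent t) in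
     Clause (at_label (Defeated (negate q)) (label s) a) {Holds (at (Body_d (label t)) a)})"

definition common_program ::
  "('p, 'f, 'v, 'l) defeasible_theory \<Rightarrow> ('p, 'f, 'v, 'l) program" where
  "common_program D =
     (\<Union>f\<in>facts D. fact_clauses f) \<union> (\<Union>r\<in>strict_rules D. strict_clauses r) \<union>
     lambda_clause ` sd_rules D \<union> (\<Union>s\<in>rules D. body_clauses s)"

definition S_program ::
  "('p, 'f, 'v, 'l) defeasible_theory \<Rightarrow> ('p, 'f, 'v, 'l) program" where
  "S_program D = common_program D \<union>
     defeasibly_clause ` sd_rules D \<union>
     overruled_clause ` rules D \<union>
     {defeated_clause t s | t s. t \<in> sd_rules D \<and> s \<in> rules D \<and>
        lit_pred (consequent s) = negate (lit_pred (consequent t)) \<and>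
        (label t, label s) \<in> superiority D}"

definition defeasibly_clause_star ::
  "('p, 'f, 'v, 'l) rule \<Rightarrow> ('p, 'f, 'v, 'l) atom clause" where
  "defeasibly_clause_star r = (let q = lit_pred (consequent r); a = lit_args (consequent r) in
     Clause (at (Defeasibly q) a)
       {Naf (at (Definitely (negate q)) a), Holds (at (Body_d (label r)) a),
        Naf (at_label (Overruled q) (label r) a)})"

definition overruled_clause_star ::
  "('p, 'f, 'v, 'l) rule \<Rightarrow> ('p, 'f, 'v, 'l) rule \<Rightarrow> ('p, 'f, 'v, 'l) atom clause" where
  "overruled_clause_star r s = (let q = lit_pred (consequent r); b = lit_args (consequent s) in
     Clause (at_label (Overruled q) (label r) b)
       {Holds (at (Body_lambda (label s)) b),
        Naf (Atom (Defeats q) [Label (label r), Label (label s)])})"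

definition S_star_program ::
  "('p, 'f, 'v, 'l) defeasible_theory \<Rightarrow> ('p, 'f, 'v, 'l) program" where
  "S_star_program D = common_program D \<union>
     defeasibly_clause_star ` sd_rules D \<union>
     {overruled_clause_star r s | r s. r \<in> sd_rules D \<and> s \<in> rules D \<and>
        lit_pred (consequent s) = negate (lit_pred (consequent r))} \<union>
     {Clause (Atom (Defeats (lit_pred (consequent r))) [Label (label r), Label l]) {} | r l.
        r \<in> rules D \<and> (label r, l) \<in> superiority D}"

primrec arg_vars :: "('f, 'v, 'l) arg \<Rightarrow> 'v set" where
  "arg_vars (Tm t) = vars t"
| "arg_vars (Label l) = {}"

primrec subst_arg :: "('v \<Rightarrow> ('f, 'v) tm) \<Rightarrow> ('f, 'v, 'l) arg \<Rightarrow> ('f, 'v, 'l) arg" where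
  "subst_arg \<sigma> (Tm t) = Tm (subst \<sigma> t)"
| "subst_arg \<sigma> (Label l) = Label l"

definition atom_vars :: "('p, 'f, 'v, 'l) atom \<Rightarrow> 'v set" where
  "atom_vars A = (\<Union>x\<in>set (atom_args A). arg_vars x)"

definition subst_atom ::
  "('v \<Rightarrow> ('f, 'v) tm) \<Rightarrow> ('p, 'f, 'v, 'l) atom \<Rightarrow> ('p, 'f, 'v, 'l) atom" where
  "subst_atom \<sigma> A = Atom (atom_pred A) (map (subst_arg \<sigma>) (atom_args A))"

definition clause_vars :: "('p, 'f, 'v, 'l) atom clause \<Rightarrow> 'v set" where
  "clause_vars c = atom_vars (clause_head c) \<union> (\<Union>l\<in>clause_body c. atom_vars (plit_atom l))"

definition subst_clause ::
  "('v \<Rightarrow> ('f, 'v) tm) \<Rightarrow> ('p, 'f, 'v, 'l) atom clause \<Rightarrow> ('p, 'f, 'v, 'l) atom clause" where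
  "subst_clause \<sigma> c =
     Clause (subst_atom \<sigma> (clause_head c)) (map_plit (subst_atom \<sigma>) ` clause_body c)"

definition ground_program ::
  "('f \<times> nat) set \<Rightarrow> ('p, 'f, 'v, 'l) program \<Rightarrow> ('p, 'f, 'v, 'l) program" where
  "ground_program \<Sigma> P =
     {subst_clause \<sigma> c | \<sigma> c. c \<in> P \<and> \<sigma> \<in> grounding_substs \<Sigma> (clause_vars c)}"

definition wf_entails ::
  "('f \<times> nat) set \<Rightarrow> ('p, 'f, 'v, 'l) program \<Rightarrow> ('p, 'f, 'v, 'l) atom plit \<Rightarrow> bool" where
  "wf_entails \<Sigma> P l \<longleftrightarrow> l \<in> well_founded_model (ground_program \<Sigma> P)"

end

theory Submission
  imports Defs
begin

text \<open>
  The \<open>definitely\<close> and \<open>lambda\<close> clauses and their body clauses are common to both programs and do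
  not depend on the rest, and the only negated atoms in them are \<open>definitely\<close> atoms. Atoms
  provable in \<open>P\<^sub>\<Delta>\<close> are derived by induction, and the underivable atoms of the definite layer form
  an unfounded set, so that this layer is two-valued in the well-founded model. With its negative
  literals available the same two steps apply to the lambda layer. Since the well-founded model is
  consistent, atoms of an unfounded set are not derived, which gives soundness.
\<close>

section \<open>Well-founded models\<close>

lemma well_founded_model_unfold:
  "well_founded_model P = wf_operator P (well_founded_model P)"
  unfolding well_founded_model_def by (rule lfp_unfold[OF mono_wf_operator])

lemma Holds_well_founded_modelI:
  assumes "Clause a B \<in> P" and "B \<subseteq> well_founded_model P"
  shows "Holds a \<in> well_founded_model P"
proof -
  have "a \<in> immediate_consequences P (well_founded_model P)"
    using assms unfolding immediate_consequences_def by force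
  then show ?thesis
    by (subst well_founded_model_unfold) (simp add: wf_operator_def)
qed

lemma Naf_well_founded_modelI:
  assumes "unfounded P (well_founded_model P) U" and "a \<in> U"
  shows "Naf a \<in> well_founded_model P"
proof -
  have "a \<in> greatest_unfounded P (well_founded_model P)"
    using assms unfolding greatest_unfounded_def by blast
  then show ?thesis
    by (subst well_founded_model_unfold) (simp add: wf_operator_def)
qed

section \<open>Consistency of the well-founded model\<close>

definition consistent :: "'a plit set \<Rightarrow> bool" where
  "consistent I \<longleftrightarrow> (\<forall>a. \<not> (Holds a \<in> I \<and> Naf a \<in> I))"

definition avoids_unfounded :: "'a clause set \<Rightarrow> 'a plit set \<Rightarrow> bool" where
  "avoids_unfounded P I \<longleftrightarrow>
     (\<forall>J U a. I \<subseteq> J \<longrightarrow> consistent J \<longrightarrow> unfounded P J U \<longrightarrow> a \<in> U \<longrightarrow> Holds a \<notin> I)"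

text \<open>A clause that fires at \<open>I\<close> has its body true there, so by consistency no
  body literal is false in the larger \<open>J\<close>. Unfoundedness is then left with its second
  alternative, a positive body atom in \<open>U\<close>.\<close>

lemma unfounded_immediate_consequence:
  assumes "consistent J" and "I \<subseteq> J" and "unfounded P J U"
    and "a \<in> U" and "a \<in> immediate_consequences P I"
  obtains b where "b \<in> U" and "Holds b \<in> I"
proof -
  obtain c where c: "c \<in> P" "clause_head c = a" "clause_body c \<subseteq> I"
    using assms(5) unfolding immediate_consequences_def by blast
  have "naf_compl l \<notin> J" if "l \<in> clause_body c" for l
    using that c(3) assms(1,2) unfolding consistent_def by (cases l) auto
  then obtain b where "b \<in> U" "Holds b \<in> clause_body c"
    using assms(3,4) c(1,2) unfolding unfounded_def by blast
  then show ?thesis using c(3) that by blast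
qed

text \<open>
  The induction along the stages of the fixpoint needs \<open>avoids_unfounded\<close>, which quantifies over
  the later stages \<open>J\<close>: an atom in a set that is unfounded only at a later stage was derived from
  an atom of the same set at an earlier one.
\<close>

lemma consistent_well_founded_model: "consistent (well_founded_model P)"
proof -
  \<comment> \<open>Consistency passes to unions of chains but not to arbitrary unions, hence the
    induction over the iteration \<open>fixp\<close> from the empty set. The middle conjunct makes
    the stages increase: it turns \<open>wf_operator P I \<subseteq> J\<close> into
    \<open>I \<subseteq> J\<close>.\<close>
  let ?Q = "\<lambda>I. consistent I \<and> I \<subseteq> wf_operator P I \<and> avoids_unfounded P I"
  have "?Q (ccpo_class.fixp (wf_operator P))"
  proof (rule ccpo_class.fixp_induct)
    show "ccpo.admissible Sup (\<le>) ?Q"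
    proof (rule ccpo.admissibleI)
      fix M :: "'a plit set set"
      assume chain: "Complete_Partial_Order.chain (\<le>) M" and M: "\<forall>I\<in>M. ?Q I"
      have "consistent (\<Union>M)"
        unfolding consistent_def
      proof (intro allI notI, elim conjE UnionE)
        fix a I J assume "Holds a \<in> I" "I \<in> M" "Naf a \<in> J" "J \<in> M"
        moreover have "I \<subseteq> J \<or> J \<subseteq> I"
          using chain \<open>I \<in> M\<close> \<open>J \<in> M\<close> unfolding Complete_Partial_Order.chain_def by blast
        ultimately show False using M unfolding consistent_def by blast
      qed
      moreover have "\<Union>M \<subseteq> wf_operator P (\<Union>M)"
      proof
        fix l assume "l \<in> \<Union>M"
        then obtain I where "I \<in> M" "l \<in> I" by blast
        then have "l \<in> wf_operator P I" using M by blast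
        then show "l \<in> wf_operator P (\<Union>M)"
          using monoD[OF mono_wf_operator, of I "\<Union>M" P] \<open>I \<in> M\<close> by blast
      qed
      moreover have "avoids_unfounded P (\<Union>M)"
        unfolding avoids_unfounded_def
      proof (intro allI impI notI, elim UnionE)
        fix J U a I
        assume "\<Union>M \<subseteq> J" "consistent J" "unfounded P J U" "a \<in> U" "Holds a \<in> I" "I \<in> M"
        moreover have "I \<subseteq> J" using \<open>\<Union>M \<subseteq> J\<close> \<open>I \<in> M\<close> by blast
        ultimately show False using M unfolding avoids_unfounded_def by blast
      qed
      ultimately show "?Q (\<Union>M)" by blast
    qed
    show "monotone (\<le>) (\<le>) (wf_operator P)"
      by (rule mono_wf_operator)
    show "?Q (Sup {})"
      by (auto simp: consistent_def avoids_unfounded_def)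
  next
    fix I assume I: "?Q I"
    have "consistent (wf_operator P I)"
      unfolding consistent_def
    proof (intro allI notI, elim conjE)
      fix a assume "Holds a \<in> wf_operator P I" and "Naf a \<in> wf_operator P I"
      then have "a \<in> immediate_consequences P I" and "a \<in> greatest_unfounded P I"
        by (auto simp: wf_operator_def)
      then obtain U where U: "unfounded P I U" "a \<in> U"
        unfolding greatest_unfounded_def by blast
      \<comment> \<open>Here \<open>I\<close> itself plays the part of the later stage
        \<open>J\<close>.\<close>
      then obtain b where "b \<in> U" "Holds b \<in> I"
        using unfounded_immediate_consequence \<open>a \<in> immediate_consequences P I\<close> I
        by (metis order_refl)
      then show False using U I unfolding avoids_unfounded_def by blast
    qed
    moreover have "wf_operator P I \<subseteq> wf_operator P (wf_operator P I)"
      using I monoD[OF mono_wf_operator] by blast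
    moreover have "avoids_unfounded P (wf_operator P I)"
      unfolding avoids_unfounded_def
    proof (intro allI impI notI)
      fix J U a
      assume J: "wf_operator P I \<subseteq> J" "consistent J"
        and U: "unfounded P J U" "a \<in> U" and a: "Holds a \<in> wf_operator P I"
      have "I \<subseteq> J" using J I by blast
      moreover have "a \<in> immediate_consequences P I"
        using a by (auto simp: wf_operator_def)
      ultimately obtain b where "b \<in> U" "Holds b \<in> I"
        using unfounded_immediate_consequence J U by metis
      then show False using U I J \<open>I \<subseteq> J\<close> unfolding avoids_unfounded_def by blast
    qed
    ultimately show "?Q (wf_operator P I)" by blast
  qed
  then show ?thesis
    unfolding well_founded_model_def by (simp add: lfp_eq_fixp mono_wf_operator)
qed

lemma unfounded_not_Holds:
  assumes "unfounded P (well_founded_model P) U" and "a \<in> U"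
  shows "Holds a \<notin> well_founded_model P"
  using Naf_well_founded_modelI[OF assms] consistent_well_founded_model[of P]
  unfolding consistent_def by blast

section \<open>Ground instances\<close>

lemma subst_ground_term: "vars t = {} \<Longrightarrow> subst \<sigma> t = t"
  by (induction t) (auto simp: map_idI)

lemma map_subst_ground:
  "Lit q ts \<in> ground_lits \<Sigma> \<Longrightarrow> map (subst \<sigma>) ts = ts"
  by (auto simp: ground_lits_def herbrand_universe_def subset_iff subst_ground_term intro!: map_idI)

lemma at_inject [simp]: "at P ts = at Q us \<longleftrightarrow> P = Q \<and> ts = us"
  by (auto simp: at_def inj_map_eq_map inj_def)

lemma at_label_pred [simp]: "atom_pred (at_label P l ts) = P"
  by (simp add: at_label_def)

lemma atom_pred_at [simp]: "atom_pred (at P ts) = P"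
  by (simp add: at_def)

lemma subst_atom_at [simp]: "subst_atom \<sigma> (at P ts) = at P (map (subst \<sigma>) ts)"
  by (simp add: at_def subst_atom_def)

lemma atom_vars_at [simp]: "atom_vars (at P ts) = (\<Union>t\<in>set ts. vars t)"
  by (simp add: at_def atom_vars_def)

lemma atom_pred_subst_atom [simp]: "atom_pred (subst_atom \<sigma> A) = atom_pred A"
  by (simp add: subst_atom_def)

lemma subst_lit_sel [simp]:
  "lit_pred (subst_lit \<sigma> b) = lit_pred b"
  "lit_args (subst_lit \<sigma> b) = map (subst \<sigma>) (lit_args b)"
  by (simp_all add: subst_lit_def)

lemma subst_rule_sel [simp]:
  "label (subst_rule \<sigma> r) = label r" "kind (subst_rule \<sigma> r) = kind r"
  "antecedent (subst_rule \<sigma> r) = subst_lit \<sigma> ` antecedent r"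
  "consequent (subst_rule \<sigma> r) = subst_lit \<sigma> (consequent r)"
  by (simp_all add: subst_rule_def)

lemma ground_theory_sel [simp]:
  "facts (ground_theory \<Sigma> D) = facts D"
  "rules (ground_theory \<Sigma> D) =
     {subst_rule \<sigma> r | \<sigma> r. r \<in> rules D \<and> \<sigma> \<in> grounding_substs \<Sigma> (rule_vars r)}"
  by (simp_all add: ground_theory_def)

section \<open>Compilation and grounding\<close>

lemma grounding_substs_antimono: "X \<subseteq> Y \<Longrightarrow> grounding_substs \<Sigma> Y \<subseteq> grounding_substs \<Sigma> X"
  by (auto simp: grounding_substs_def)

text \<open>Substitutions leave labels and signed predicates untouched, so compilation commutes with
  instantiation. This and the next two lemmas carry ground rules over to ground clauses.\<close>

lemma strict_clauses_subst:
  "strict_clauses (subst_rule \<sigma> r) = subst_clause \<sigma> ` strict_clauses r"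
  by (simp add: strict_clauses_def Let_def subst_clause_def image_image)

lemma lambda_clause_subst:
  "lambda_clause (subst_rule \<sigma> r) = subst_clause \<sigma> (lambda_clause r)"
  by (simp add: lambda_clause_def Let_def subst_clause_def)

lemma body_clauses_subst:
  "body_clauses (subst_rule \<sigma> r) = subst_clause \<sigma> ` body_clauses r"
  by (simp add: body_clauses_def Let_def subst_clause_def image_image)

lemma fact_clauses_subst:
  "f \<in> ground_lits \<Sigma> \<Longrightarrow> c \<in> fact_clauses f \<Longrightarrow> subst_clause \<sigma> c = c"
  using map_subst_ground[of "lit_pred f" "lit_args f" \<Sigma> \<sigma>]
  by (auto simp: fact_clauses_def Let_def subst_clause_def)

text \<open>Ensures that a substitution grounding a rule also grounds every clause compiled from
  it.\<close>

lemma clause_vars_rule_clauses: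
  "c \<in> strict_clauses r \<Longrightarrow> clause_vars c \<subseteq> rule_vars r"
  "clause_vars (lambda_clause r) \<subseteq> rule_vars r"
  "c \<in> body_clauses r \<Longrightarrow> clause_vars c \<subseteq> rule_vars r"
  by (auto simp: strict_clauses_def lambda_clause_def body_clauses_def Let_def clause_vars_def
      rule_vars_def lit_vars_def)

text \<open>The body clauses mention every variable of the rule, the others only those of its
  consequent. So grounding a body clause yields a genuine ground instance of the rule.\<close>

lemma clause_vars_body:
  "clause_vars (Clause (at P (lit_args (consequent r)))
     ((\<lambda>b. Holds (at (Q (lit_pred b)) (lit_args b))) ` antecedent r)) = rule_vars r"
  by (auto simp: clause_vars_def rule_vars_def lit_vars_def)

lemma ground_programI:
  "c \<in> P \<Longrightarrow> \<sigma> \<in> grounding_substs \<Sigma> (clause_vars c) \<Longrightarrow> subst_clause \<sigma> c \<in> ground_program \<Sigma> P"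
  unfolding ground_program_def by blast

lemma fact_clauses_ground_program:
  assumes "facts D \<subseteq> ground_lits \<Sigma>" and "f \<in> facts D"
  shows "fact_clauses f \<subseteq> ground_program \<Sigma> (common_program D)"
proof
  fix c :: "('a, 'b, 'c, 'd) atom clause" assume c: "c \<in> fact_clauses f"
  have "clause_vars c = {}"
    using c subsetD[OF assms] by (fastforce simp: fact_clauses_def Let_def clause_vars_def
        ground_lits_def herbrand_universe_def)
  \<comment> \<open>With no variables to ground, every substitution is admissible, so
    \<open>Var\<close> serves even over an empty Herbrand universe.\<close>
  then have "subst_clause Var c \<in> ground_program \<Sigma> (common_program D)"
    using c assms(2) by (intro ground_programI) (auto simp: common_program_def grounding_substs_def)
  then show "c \<in> ground_program \<Sigma> (common_program D)"
    using fact_clauses_subst c assms by (metis subsetD)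
qed

text \<open>Provides the clauses for derivability. The converse inclusion can fail: over an empty
  Herbrand universe a rule with variables only in its antecedent has no ground instance, yet its
  \<open>lambda_clause\<close> is variable-free and remains in the program.\<close>

lemma common_program_ground_theory:
  assumes "facts D \<subseteq> ground_lits \<Sigma>"
  shows "common_program (ground_theory \<Sigma> D) \<subseteq> ground_program \<Sigma> (common_program D)"
proof -
  let ?G = "ground_program \<Sigma> (common_program D)"
  have mem: "s \<in> strict_rules D \<Longrightarrow> c \<in> strict_clauses s \<Longrightarrow> c \<in> common_program D"
    "s \<in> sd_rules D \<Longrightarrow> lambda_clause s \<in> common_program D"
    "s \<in> rules D \<Longrightarrow> c \<in> body_clauses s \<Longrightarrow> c \<in> common_program D" for s c
    unfolding common_program_def by blast+
  have inst: "subst_clause \<sigma> c \<in> ?G"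
    if "c \<in> common_program D" "clause_vars c \<subseteq> rule_vars r" "\<sigma> \<in> grounding_substs \<Sigma> (rule_vars r)"
    for \<sigma> c r
    using that grounding_substs_antimono[OF that(2)] by (blast intro: ground_programI)
  have "strict_clauses r \<subseteq> ?G" if r: "r \<in> strict_rules (ground_theory \<Sigma> D)" for r
  proof -
    obtain \<sigma> s where s: "r = subst_rule \<sigma> s" "s \<in> strict_rules D"
      "\<sigma> \<in> grounding_substs \<Sigma> (rule_vars s)"
      using r by (auto simp: strict_rules_def)
    then show ?thesis
      unfolding s(1) strict_clauses_subst
      using s(2) by (auto intro!: inst[OF mem(1) _ s(3)] clause_vars_rule_clauses(1))
  qed
  moreover have "lambda_clause r \<in> ?G" if r: "r \<in> sd_rules (ground_theory \<Sigma> D)" for r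
  proof -
    obtain \<sigma> s where s: "r = subst_rule \<sigma> s" "s \<in> sd_rules D"
      "\<sigma> \<in> grounding_substs \<Sigma> (rule_vars s)"
      using r by (auto simp: sd_rules_def)
    then show ?thesis
      unfolding s(1) lambda_clause_subst
      using s(2) by (auto intro!: inst[OF mem(2) _ s(3)] clause_vars_rule_clauses(2))
  qed
  moreover have "body_clauses r \<subseteq> ?G" if r: "r \<in> rules (ground_theory \<Sigma> D)" for r
  proof -
    obtain \<sigma> s where s: "r = subst_rule \<sigma> s" "s \<in> rules D"
      "\<sigma> \<in> grounding_substs \<Sigma> (rule_vars s)"
      using r by auto
    then show ?thesis
      unfolding s(1) body_clauses_subst
      using s(2) by (auto intro!: inst[OF mem(3) _ s(3)] clause_vars_rule_clauses(3))
  qed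
  moreover have "fact_clauses f \<subseteq> ?G" if "f \<in> facts D" for f
    using fact_clauses_ground_program[OF assms that] .
  ultimately show ?thesis
    unfolding common_program_def[of "ground_theory \<Sigma> D"] ground_theory_sel(1) by blast
qed

section \<open>The definite and the lambda layer\<close>

definition Delta_layer :: "('p, 'f, 'v, 'l) atom set" where
  "Delta_layer = {A. (\<exists>q. atom_pred A = Definitely q) \<or> (\<exists>l. atom_pred A = Body_Delta l)}"

definition lambda_layer :: "('p, 'f, 'v, 'l) atom set" where
  "lambda_layer = {A. (\<exists>q. atom_pred A = Lambda q) \<or> (\<exists>l. atom_pred A = Body_lambda l)}"

text \<open>The atoms of the definite layer that ought to be true. A body atom keeps only the
  arguments of the consequent, so instances of a rule that differ only in their antecedents share
  it, and one satisfied antecedent suffices.\<close>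

definition Delta_atoms ::
  "('p, 'f, 'v, 'l) defeasible_theory \<Rightarrow> ('p, 'f, 'v, 'l) atom set" where
  "Delta_atoms E = {at (Definitely q) a | q a. Lit q a \<in> P_Delta E} \<union>
     {at (Body_Delta (label r)) (lit_args (consequent r)) | r.
        r \<in> strict_rules E \<and> antecedent r \<subseteq> P_Delta E}"

text \<open>Unlike in \<open>Delta_atoms\<close>, body atoms come from all of
  \<open>rules E\<close>, since defeaters have \<open>Body_lambda\<close> clauses too.\<close>

definition lambda_atoms ::
  "('p, 'f, 'v, 'l) defeasible_theory \<Rightarrow> ('p, 'f, 'v, 'l) atom set" where
  "lambda_atoms E = {at (Lambda q) a | q a. Lit q a \<in> P_lambda E} \<union>
     {at (Body_lambda (label r)) (lit_args (consequent r)) | r.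
        r \<in> rules E \<and> antecedent r \<subseteq> P_lambda E}"

lemma Definitely_Delta_atoms [simp]: "at (Definitely q) a \<in> Delta_atoms E \<longleftrightarrow> Lit q a \<in> P_Delta E"
  by (auto simp: Delta_atoms_def)

lemma Lambda_lambda_atoms [simp]: "at (Lambda q) a \<in> lambda_atoms E \<longleftrightarrow> Lit q a \<in> P_lambda E"
  by (auto simp: lambda_atoms_def)

lemma Body_Delta_Delta_atoms [simp]:
  "at (Body_Delta l) a \<in> Delta_atoms E \<longleftrightarrow>
     (\<exists>r\<in>strict_rules E. label r = l \<and> lit_args (consequent r) = a \<and> antecedent r \<subseteq> P_Delta E)"
  by (auto simp: Delta_atoms_def)

lemma Body_lambda_lambda_atoms [simp]:
  "at (Body_lambda l) a \<in> lambda_atoms E \<longleftrightarrow>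
     (\<exists>r\<in>rules E. label r = l \<and> lit_args (consequent r) = a \<and> antecedent r \<subseteq> P_lambda E)"
  by (auto simp: lambda_atoms_def)

lemma P_Delta_strict: "r \<in> strict_rules D \<Longrightarrow> antecedent r \<subseteq> P_Delta D \<Longrightarrow> consequent r \<in> P_Delta D"
  by (auto intro: P_Delta.strict)

lemma P_lambda_sd:
  "r \<in> sd_rules D \<Longrightarrow> antecedent r \<subseteq> P_lambda D \<Longrightarrow> complement (consequent r) \<notin> P_Delta D \<Longrightarrow>
     consequent r \<in> P_lambda D"
  by (auto intro: P_lambda.sd)

text \<open>\<open>X\<close> collects the clauses for \<open>defeasibly\<close>, \<open>overruled\<close>, \<open>defeated\<close> and \<open>defeats\<close>.\<close>

locale compiled_program =
  fixes \<Sigma> :: "('f \<times> nat) set"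
    and D :: "('p, 'f, 'v, 'l) defeasible_theory"
    and X :: "('p, 'f, 'v, 'l) program"
  assumes theory_D: "is_defeasible_theory \<Sigma> D"
    and heads_X: "\<And>c. c \<in> X \<Longrightarrow> clause_head c \<notin> Delta_layer \<union> lambda_layer"
begin

abbreviation E :: "('p, 'f, 'v, 'l) defeasible_theory" where
  "E \<equiv> ground_theory \<Sigma> D"

abbreviation G :: "('p, 'f, 'v, 'l) program" where
  "G \<equiv> ground_program \<Sigma> (common_program D \<union> X)"

abbreviation W :: "('p, 'f, 'v, 'l) atom plit set" where
  "W \<equiv> well_founded_model G"

section \<open>Ground clauses with a head in one of the layers\<close>

lemma facts_ground: "facts D \<subseteq> ground_lits \<Sigma>"
  using theory_D by (simp add: is_defeasible_theory_def)

lemma same_label: "r \<in> rules D \<Longrightarrow> s \<in> rules D \<Longrightarrow> label r = label s \<Longrightarrow> r = s"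
  using theory_D by (auto simp: is_defeasible_theory_def inj_on_def)

lemma common_program_G: "c \<in> common_program E \<Longrightarrow> c \<in> G"
  using common_program_ground_theory[OF facts_ground] unfolding ground_program_def by blast

text \<open>Instantiation preserves the predicate of the head, so \<open>heads_X\<close> already
  excludes \<open>X\<close> before grounding. The rule stays uninstantiated because
  \<open>\<sigma>\<close> need only ground the clause and may leave other rule variables
  open.\<close>

lemma layer_clauseE:
  assumes "c \<in> G" and "clause_head c \<in> Delta_layer \<union> lambda_layer"
  obtains (fact) f where "f \<in> facts D" and "c \<in> fact_clauses f"
  | (rule) \<sigma> r c0 where "r \<in> rules D" and "c = subst_clause \<sigma> c0"
      and "\<sigma> \<in> grounding_substs \<Sigma> (clause_vars c0)"
      and "kind r = Strict \<and> c0 \<in> strict_clauses r \<or> r \<in> sd_rules D \<and> c0 = lambda_clause r \<or>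
        c0 \<in> body_clauses r"
proof -
  obtain \<sigma> c0 where c0: "c = subst_clause \<sigma> c0" "c0 \<in> common_program D \<union> X"
    "\<sigma> \<in> grounding_substs \<Sigma> (clause_vars c0)"
    using assms(1) unfolding ground_program_def by blast
  have "clause_head c0 \<in> Delta_layer \<union> lambda_layer"
    using assms(2) c0(1) by (simp add: subst_clause_def Delta_layer_def lambda_layer_def)
  then have "c0 \<in> common_program D" using c0(2) heads_X by blast
  then consider f where "f \<in> facts D" "c0 \<in> fact_clauses f"
    | r where "r \<in> rules D" "kind r = Strict \<and> c0 \<in> strict_clauses r \<or>
        r \<in> sd_rules D \<and> c0 = lambda_clause r \<or> c0 \<in> body_clauses r"
    unfolding common_program_def strict_rules_def sd_rules_def by blast
  then show thesis
  proof cases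
    case 1
    then have "c = c0" using fact_clauses_subst facts_ground c0(1) by blast
    then show ?thesis using 1 fact by blast
  next
    case 2
    then show ?thesis using c0 rule by blast
  qed
qed

text \<open>Labels are unique in \<open>D\<close>, so a ground rule labelled like \<open>r\<close>
  is an instance of \<open>r\<close>. Hence the label in a body atom determines the signed predicate
  of the consequent and the kind.\<close>

lemma same_label_ground:
  assumes "r \<in> rules D" and "r' \<in> rules E" and "label r' = label r"
  shows "lit_pred (consequent r') = lit_pred (consequent r)" and "kind r' = kind r"
proof -
  obtain \<tau> s where s: "r' = subst_rule \<tau> s" "s \<in> rules D"
    using assms(2) by auto
  then have "s = r" using same_label assms by simp
  then show "lit_pred (consequent r') = lit_pred (consequent r)" and "kind r' = kind r"
    using s by simp_all
qed

text \<open>The instance \<open>s\<close> that makes the body atom true need not be the one the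
  clause at hand came from, but label and arguments force it to have the same consequent.\<close>

lemma Body_Delta_P_Delta:
  assumes "r \<in> rules D" and "at (Body_Delta (label r)) a \<in> Delta_atoms E"
  shows "Lit (lit_pred (consequent r)) a \<in> P_Delta E"
proof -
  obtain s where s: "s \<in> strict_rules E" "label s = label r"
    "lit_args (consequent s) = a" "antecedent s \<subseteq> P_Delta E"
    using assms(2) by auto
  then have "consequent s = Lit (lit_pred (consequent r)) a"
    using same_label_ground(1)[OF assms(1), of s] by (metis (no_types, lifting) lit.collapse
        mem_Collect_eq strict_rules_def)
  then show ?thesis using P_Delta_strict s(1,4) by metis
qed

lemma Body_lambda_P_lambda:
  assumes "r \<in> sd_rules D" and "at (Body_lambda (label r)) a \<in> lambda_atoms E"
    and "Lit (negate (lit_pred (consequent r))) a \<notin> P_Delta E"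
  shows "Lit (lit_pred (consequent r)) a \<in> P_lambda E"
proof -
  have r: "r \<in> rules D" using assms(1) by (simp add: sd_rules_def)
  obtain s where s: "s \<in> rules E" "label s = label r"
    "lit_args (consequent s) = a" "antecedent s \<subseteq> P_lambda E"
    using assms(2) by (auto simp del: ground_theory_sel)
  then have eq: "consequent s = Lit (lit_pred (consequent r)) a"
    using same_label_ground(1)[OF r, of s] by (metis lit.collapse)
  \<comment> \<open>A \<open>Body_lambda\<close> atom may stem from a defeater; the shared label
    transfers the kind of \<open>r\<close> to \<open>s\<close> and rules this out.\<close>
  have "s \<in> sd_rules E"
    using assms(1) s(1) same_label_ground(2)[OF r s(1,2)] unfolding sd_rules_def by simp
  then have "consequent s \<in> P_lambda E"
    by (rule P_lambda_sd) (use s(4) eq assms(3) in \<open>simp_all add: complement_def\<close>)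
  then show ?thesis by (simp add: eq)
qed

section \<open>The definite layer is two-valued\<close>

text \<open>The clauses of this layer are negation-free and refer only to the layer itself, so the
  second alternative of unfoundedness always applies and \<open>I\<close> may be arbitrary.\<close>

lemma unfounded_Delta: "unfounded G I (Delta_layer - Delta_atoms E)"
  unfolding unfounded_def
proof (intro ballI impI disjI2)
  fix c assume c: "c \<in> G" and head: "clause_head c \<in> Delta_layer - Delta_atoms E"
  have "clause_head c \<in> Delta_layer \<union> lambda_layer" using head by blast
  with c show "\<exists>a\<in>Delta_layer - Delta_atoms E. Holds a \<in> clause_body c"
  proof (cases rule: layer_clauseE)
    case (fact f)
    have "f \<in> P_Delta E" using fact(1) by (simp add: P_Delta.fact)
    then have False
      using fact(2) head by (auto simp: fact_clauses_def Let_def Delta_layer_def)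
    then show ?thesis ..
  next
    case (rule \<sigma> r c0)
    let ?q = "lit_pred (consequent r)" and ?a = "map (subst \<sigma>) (lit_args (consequent r))"
    \<comment> \<open>The only clause shapes whose heads belong to the layer. For the body clause,
      \<open>clause_vars_body\<close> makes \<open>\<sigma>\<close> ground the whole rule.\<close>
    consider
      "kind r = Strict" "c = Clause (at (Definitely ?q) ?a) {Holds (at (Body_Delta (label r)) ?a)}"
    | "kind r = Strict" "\<sigma> \<in> grounding_substs \<Sigma> (rule_vars r)"
      "c = Clause (at (Body_Delta (label r)) ?a)
        ((\<lambda>b. Holds (at (Definitely (lit_pred b)) (lit_args b))) ` subst_lit \<sigma> ` antecedent r)"
      using rule(2-4) head
      by (auto simp: strict_clauses_def lambda_clause_def body_clauses_def Let_def subst_clause_def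
          Delta_layer_def clause_vars_body image_image)
    then show ?thesis
    proof cases
      case 1
      have "at (Body_Delta (label r)) ?a \<notin> Delta_atoms E"
        using Body_Delta_P_Delta[OF rule(1)] head 1 by auto
      then show ?thesis using 1 by (auto simp: Delta_layer_def)
    next
      case 2
      have "subst_rule \<sigma> r \<in> strict_rules E"
        using rule(1) 2 by (auto simp: strict_rules_def)
      \<comment> \<open>Otherwise this instance would put the head of the clause into
        \<open>Delta_atoms E\<close>.\<close>
      then have "\<not> subst_lit \<sigma> ` antecedent r \<subseteq> P_Delta E"
        using head 2 by force
      then obtain b where "b \<in> subst_lit \<sigma> ` antecedent r" "b \<notin> P_Delta E" by blast
      then show ?thesis
        using 2 by (intro bexI[of _ "at (Definitely (lit_pred b)) (lit_args b)"])
          (auto simp: Delta_layer_def)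
    qed
  qed
qed

text \<open>The premise speaks of \<open>W\<close> rather than \<open>P_Delta\<close>, so that it
  matches the induction hypothesis of \<open>P_Delta_Holds\<close>; the \<open>Lambda\<close>
  clauses of strict rules use it as well.\<close>

lemma Body_Delta_Holds:
  assumes "r \<in> strict_rules E"
    and "\<forall>b\<in>antecedent r. Holds (at (Definitely (lit_pred b)) (lit_args b)) \<in> W"
  shows "Holds (at (Body_Delta (label r)) (lit_args (consequent r))) \<in> W"
proof -
  have cl: "strict_clauses r \<subseteq> G"
    using assms(1) common_program_G unfolding common_program_def by blast
  show ?thesis
    by (rule Holds_well_founded_modelI[OF subsetD[OF cl]])
      (use assms in \<open>auto simp: strict_clauses_def Let_def\<close>)
qed

lemma P_Delta_Holds: "b \<in> P_Delta E \<Longrightarrow> Holds (at (Definitely (lit_pred b)) (lit_args b)) \<in> W"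
proof (induction rule: P_Delta.induct)
  case (fact b)
  show ?case
    by (rule Holds_well_founded_modelI[of _ "{}"], rule common_program_G)
      (use fact in \<open>auto simp: common_program_def fact_clauses_def Let_def\<close>)
next
  case (strict r b)
  let ?B = "at (Body_Delta (label r)) (lit_args (consequent r))"
  have cl: "strict_clauses r \<subseteq> G"
    using strict(1) common_program_G unfolding common_program_def by blast
  have "Holds ?B \<in> W"
    using strict by (intro Body_Delta_Holds) blast+
  then show ?case
    by (intro Holds_well_founded_modelI[OF subsetD[OF cl], of _ "{Holds ?B}"])
      (use strict in \<open>auto simp: strict_clauses_def Let_def\<close>)
qed

lemma Holds_Definitely_iff: "Holds (at (Definitely q) a) \<in> W \<longleftrightarrow> Lit q a \<in> P_Delta E"
proof
  assume "Holds (at (Definitely q) a) \<in> W"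
  then have "at (Definitely q) a \<notin> Delta_layer - Delta_atoms E"
    using unfounded_not_Holds[OF unfounded_Delta] by blast
  then show "Lit q a \<in> P_Delta E" by (auto simp: Delta_layer_def)
next
  assume "Lit q a \<in> P_Delta E"
  then show "Holds (at (Definitely q) a) \<in> W" using P_Delta_Holds by fastforce
qed

lemma Naf_Definitely:
  assumes "Lit q a \<notin> P_Delta E"
  shows "Naf (at (Definitely q) a) \<in> W"
  by (rule Naf_well_founded_modelI[OF unfounded_Delta]) (use assms in \<open>auto simp: Delta_layer_def\<close>)

section \<open>The lambda layer is two-valued\<close>

text \<open>Clauses of this layer also consult definite atoms. Since \<open>W\<close> decides those,
  a body failing on one of them meets the first alternative of unfoundedness; the rest fail on an
  atom of the layer itself.\<close>

lemma unfounded_lambda: "unfounded G W (lambda_layer - lambda_atoms E)"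
  unfolding unfounded_def
proof (intro ballI impI)
  fix c assume c: "c \<in> G" and head: "clause_head c \<in> lambda_layer - lambda_atoms E"
  have "clause_head c \<in> Delta_layer \<union> lambda_layer" using head by blast
  with c show "(\<exists>l\<in>clause_body c. naf_compl l \<in> W) \<or>
    (\<exists>a\<in>lambda_layer - lambda_atoms E. Holds a \<in> clause_body c)"
  proof (cases rule: layer_clauseE)
    case (fact f)
    have "f \<in> P_lambda E" using fact(1) by (simp add: P_Delta.fact P_lambda.Delta)
    then have False
      using fact(2) head by (auto simp: fact_clauses_def Let_def lambda_layer_def)
    then show ?thesis ..
  next
    case (rule \<sigma> r c0)
    let ?q = "lit_pred (consequent r)" and ?a = "map (subst \<sigma>) (lit_args (consequent r))"
    consider
      "c = Clause (at (Lambda ?q) ?a) {Holds (at (Body_Delta (label r)) ?a)}"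
    | "r \<in> sd_rules D" "c = Clause (at (Lambda ?q) ?a)
        {Naf (at (Definitely (negate ?q)) ?a), Holds (at (Body_lambda (label r)) ?a)}"
    | "\<sigma> \<in> grounding_substs \<Sigma> (rule_vars r)"
      "c = Clause (at (Body_lambda (label r)) ?a)
        ((\<lambda>b. Holds (at (Lambda (lit_pred b)) (lit_args b))) ` subst_lit \<sigma> ` antecedent r)"
      using rule(2-4) head
      by (auto simp: strict_clauses_def lambda_clause_def body_clauses_def Let_def subst_clause_def
          lambda_layer_def clause_vars_body image_image)
    then show ?thesis
    proof cases
      case 1
      \<comment> \<open>As \<open>P_lambda\<close> contains \<open>P_Delta\<close>, an underivable
        head excludes the strict body, which is thus false in \<open>W\<close>.\<close>
      then have "Lit ?q ?a \<notin> P_Delta E" using head by (auto intro: P_lambda.Delta)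
      then have "at (Body_Delta (label r)) ?a \<in> Delta_layer - Delta_atoms E"
        using Body_Delta_P_Delta[OF rule(1)] by (auto simp: Delta_layer_def)
      then have "Naf (at (Body_Delta (label r)) ?a) \<in> W"
        by (rule Naf_well_founded_modelI[OF unfounded_Delta])
      then show ?thesis using 1 by simp
    next
      case 2
      show ?thesis
      \<comment> \<open>If the complement is definitely provable, the negated literal fails in
        \<open>W\<close>; if not, \<open>Body_lambda_P_lambda\<close> makes the body atom
        underivable.\<close>
      proof (cases "Lit (negate ?q) ?a \<in> P_Delta E")
        case True
        then show ?thesis using 2 P_Delta_Holds[OF True] by simp
      next
        case False
        then have "at (Body_lambda (label r)) ?a \<notin> lambda_atoms E"
          using Body_lambda_P_lambda[OF 2(1)] head 2 by auto
        then show ?thesis using 2 by (auto simp: lambda_layer_def simp del: Body_lambda_lambda_atoms)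
      qed
    next
      case 3
      have "subst_rule \<sigma> r \<in> rules E" using rule(1) 3 by auto
      then have "\<not> subst_lit \<sigma> ` antecedent r \<subseteq> P_lambda E"
        using head 3(2) by (force simp del: ground_theory_sel)
      then obtain b where "b \<in> subst_lit \<sigma> ` antecedent r" "b \<notin> P_lambda E" by blast
      then show ?thesis
        using 3 by (intro disjI2 bexI[of _ "at (Lambda (lit_pred b)) (lit_args b)"])
          (auto simp: lambda_layer_def)
    qed
  qed
qed

lemma P_lambda_Holds: "b \<in> P_lambda E \<Longrightarrow> Holds (at (Lambda (lit_pred b)) (lit_args b)) \<in> W"
proof (induction rule: P_lambda.induct)
  case (Delta b)
  \<comment> \<open>No clause leads from \<open>Definitely\<close> to \<open>Lambda\<close>. Instead
    the last step of the \<open>P_Delta\<close> derivation is replayed with the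
    \<open>Lambda\<close> clause of the same fact or strict rule.\<close>
  then show ?case
  proof cases
    case fact
    show ?thesis
      by (rule Holds_well_founded_modelI[of _ "{}"], rule common_program_G)
        (use fact in \<open>auto simp: common_program_def fact_clauses_def Let_def\<close>)
  next
    case (strict r)
    have cl: "strict_clauses r \<subseteq> G"
      using strict(1) common_program_G unfolding common_program_def by blast
    show ?thesis
      by (intro Holds_well_founded_modelI[OF subsetD[OF cl],
            of _ "{Holds (at (Body_Delta (label r)) (lit_args (consequent r)))}"])
        (use strict Body_Delta_Holds P_Delta_Holds in \<open>auto simp: strict_clauses_def Let_def\<close>)
  qed
next
  case (sd r b)
  let ?a = "lit_args (consequent r)"
  have "r \<in> rules E" using sd(1) by (simp add: sd_rules_def)
  then have body: "body_clauses r \<subseteq> G"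
    using common_program_G unfolding common_program_def by blast
  have lam: "lambda_clause r \<in> G"
    using sd(1) common_program_G unfolding common_program_def by blast
  have "Holds (at (Body_lambda (label r)) ?a) \<in> W"
    by (rule Holds_well_founded_modelI[OF subsetD[OF body]])
      (use sd in \<open>auto simp: body_clauses_def Let_def\<close>)
  \<comment> \<open>Non-membership in \<open>P_Delta\<close> becomes a true negative literal because
    the definite layer is two-valued.\<close>
  moreover have "Naf (at (Definitely (negate (lit_pred b))) (lit_args b)) \<in> W"
    using sd(3) by (intro Naf_Definitely) (simp add: complement_def del: ground_theory_sel)
  ultimately show ?case
    using sd(2) lam unfolding lambda_clause_def Let_def
    by (intro Holds_well_founded_modelI) auto
qed

lemma Holds_Lambda_iff: "Holds (at (Lambda q) a) \<in> W \<longleftrightarrow> Lit q a \<in> P_lambda E"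
proof
  assume "Holds (at (Lambda q) a) \<in> W"
  then have "at (Lambda q) a \<notin> lambda_layer - lambda_atoms E"
    using unfounded_not_Holds[OF unfounded_lambda] by blast
  then show "Lit q a \<in> P_lambda E" by (auto simp: lambda_layer_def)
next
  assume "Lit q a \<in> P_lambda E"
  then show "Holds (at (Lambda q) a) \<in> W" using P_lambda_Holds by fastforce
qed

end

section \<open>The two compiled programs\<close>

lemma S_program_wf_entails:
  assumes "is_defeasible_theory \<Sigma> D"
  shows "wf_entails \<Sigma> (S_program D) (Holds (at (Definitely q) a)) \<longleftrightarrow>
      Lit q a \<in> P_Delta (ground_theory \<Sigma> D)"
    and "wf_entails \<Sigma> (S_program D) (Holds (at (Lambda q) a)) \<longleftrightarrow>
      Lit q a \<in> P_lambda (ground_theory \<Sigma> D)"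
proof -
  define X where "X = defeasibly_clause ` sd_rules D \<union> overruled_clause ` rules D \<union>
     {defeated_clause t s | t s. t \<in> sd_rules D \<and> s \<in> rules D \<and>
        lit_pred (consequent s) = negate (lit_pred (consequent t)) \<and>
        (label t, label s) \<in> superiority D}"
  \<comment> \<open>The heads in \<open>X\<close> are \<open>Defeasibly\<close>,
    \<open>Overruled\<close> and \<open>Defeated\<close> atoms, outside both layers.\<close>
  interpret compiled_program \<Sigma> D X
    by unfold_locales (use assms in \<open>auto simp: X_def defeasibly_clause_def overruled_clause_def
        defeated_clause_def Let_def Delta_layer_def lambda_layer_def\<close>)
  have "S_program D = common_program D \<union> X"
    unfolding S_program_def X_def by blast
  then show "wf_entails \<Sigma> (S_program D) (Holds (at (Definitely q) a)) \<longleftrightarrow>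
      Lit q a \<in> P_Delta (ground_theory \<Sigma> D)"
    and "wf_entails \<Sigma> (S_program D) (Holds (at (Lambda q) a)) \<longleftrightarrow>
      Lit q a \<in> P_lambda (ground_theory \<Sigma> D)"
    using Holds_Definitely_iff Holds_Lambda_iff by (simp_all add: wf_entails_def)
qed

lemma S_star_program_wf_entails:
  assumes "is_defeasible_theory \<Sigma> D"
  shows "wf_entails \<Sigma> (S_star_program D) (Holds (at (Definitely q) a)) \<longleftrightarrow>
      Lit q a \<in> P_Delta (ground_theory \<Sigma> D)"
    and "wf_entails \<Sigma> (S_star_program D) (Holds (at (Lambda q) a)) \<longleftrightarrow>
      Lit q a \<in> P_lambda (ground_theory \<Sigma> D)"
proof -
  define X where "X = defeasibly_clause_star ` sd_rules D \<union>
     {overruled_clause_star r s | r s. r \<in> sd_rules D \<and> s \<in> rules D \<and>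
        lit_pred (consequent s) = negate (lit_pred (consequent r))} \<union>
     {Clause (Atom (Defeats (lit_pred (consequent r))) [Label (label r), Label l]) {} | r l.
        r \<in> rules D \<and> (label r, l) \<in> superiority D}"
  \<comment> \<open>Here the heads are \<open>Defeasibly\<close>, \<open>Overruled\<close> and
    \<open>Defeats\<close> atoms, so the same argument applies.\<close>
  interpret compiled_program \<Sigma> D X
    by unfold_locales (use assms in \<open>auto simp: X_def defeasibly_clause_star_def
        overruled_clause_star_def Let_def Delta_layer_def lambda_layer_def\<close>)
  have "S_star_program D = common_program D \<union> X"
    unfolding S_star_program_def X_def by blast
  then show "wf_entails \<Sigma> (S_star_program D) (Holds (at (Definitely q) a)) \<longleftrightarrow>
      Lit q a \<in> P_Delta (ground_theory \<Sigma> D)"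
    and "wf_entails \<Sigma> (S_star_program D) (Holds (at (Lambda q) a)) \<longleftrightarrow>
      Lit q a \<in> P_lambda (ground_theory \<Sigma> D)"
    using Holds_Definitely_iff Holds_Lambda_iff by (simp_all add: wf_entails_def)
qed

theorem theorem4:
  fixes \<Sigma> :: "('f \<times> nat) set"
    and D :: "('p, 'f, 'v, 'l) defeasible_theory"
    and q :: "'p signed"
    and a :: "('f, 'v) tm list"
  assumes "is_defeasible_theory \<Sigma> D"
    and "Lit q a \<in> ground_lits \<Sigma>"
  shows "(Lit q a \<in> P_Delta (ground_theory \<Sigma> D) \<longleftrightarrow>
            wf_entails \<Sigma> (S_program D) (Holds (at (Definitely q) a))) \<and>
         (wf_entails \<Sigma> (S_program D) (Holds (at (Definitely q) a)) \<longleftrightarrow>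
            wf_entails \<Sigma> (S_star_program D) (Holds (at (Definitely q) a))) \<and>
         (Lit q a \<in> P_lambda (ground_theory \<Sigma> D) \<longleftrightarrow>
            wf_entails \<Sigma> (S_program D) (Holds (at (Lambda q) a))) \<and>
         (wf_entails \<Sigma> (S_program D) (Holds (at (Lambda q) a)) \<longleftrightarrow>
            wf_entails \<Sigma> (S_star_program D) (Holds (at (Lambda q) a)))"
  using S_program_wf_entails[OF assms(1)] S_star_program_wf_entails[OF assms(1)] by simp

end
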